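(* Let $X=[\ell,u]\subseteq\mathbb{R}^n$ be a box with $\ell_i<u_i$ for all $i$, and assume $g:\mathbb{R}^n\to\mathbb{R}$ is a closed proper convex function which is non-polyhedral. Let Algorithm 1 (defined in the context) be run with $\epsilon=0$, so that it runs indefinitely and generates infinite sequences $(C^k)_{k\ge0}$ and $(g^k)_{k\ge 0}$. Let $A=\operatorname{epi}g\cap(X\times\mathbb{R})\cap S$ and $A^k=\operatorname{epi}g^k\cap(X\times\mathbb{R})\cap S=C^k\cap S$ for $k\ge0$, where $S=\{(x,t)\in\mathbb{R}^n\times\mathbb{R}\mid t\le b\}$ and $b=\sup_{x\in X}g(x)$. Then: (a) The approximation error for the sequence $(A^k)_{k\ge0}$ decreases by the order $\mathcal{O}(k^{-1/n})$, i.e. $\delta^H(A^k,A)=\mathcal{O}(k^{-1/n})$ as $k\to\infty$. (b) $\lim_{k\to\infty}\delta^H(A^k,A)=0$.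
   Context: $X=\{x\in\mathbb{R}^n\mid \ell_i\le x_i\le u_i,\ i=1,\dots,n\}$. For $x\in\mathbb{R}^n$, $c(x)$ denotes an (arbitrary, chosen) element of the subdifferential $\partial g(x)$, and for $x^*\in\mathbb{R}^n$, $$H(g,x^* )=\{(x,t)\in\mathbb{R}^n\times\mathbb{R}\mid t-c(x^* )^{\mathsf T}x\ge g(x^* )-c(x^* )^{\mathsf T}x^*\}.$$ $\operatorname{vert} C$ denotes the set of vertices of a polyhedral convex set $C$; $\operatorname{epi}$ denotes the epigraph. With respect to a fixed norm on $\mathbb{R}^{n+1}$, $d(y,B)=\inf_{x\in B}\|y-x\|$ and $\delta^H(A,B)=\max\{\sup_{x\in A}d(x,B),\sup_{y\in B}d(y,A)\}$ is the Hausdorff distance. Algorithm 1 (input $g$, $X=[\ell,u]$, $\epsilon$): Set $k=0$, $x^0=\frac{\ell+u}{2}$, $C^0=H(g,x^0)\cap(X\times\mathbb{R})$, $g^0(x)=g(x^0)+c(x^0)^{\mathsf T}(x-x^0)$. Repeat: compute $\operatorname{vert}C^k$ and choose $(\bar x,\bar y)\in\arg\max_{(x,y)\in\operatorname{vert}C^k}(g(x)-y)$. If $g(\bar x)-\bar y>\epsilon$, set $C^{k+1}=C^k\cap H(g,\bar x)$, $g^{k+1}(x)=\max\{g^k(x),\,g(\bar x)+c(\bar x)^{\mathsf T}(x-\bar x)\}$, and increase $k$ by $1$; otherwise stop and return $g^k$ (and $\operatorname{vert}C^k$). *)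

theory Defs
  imports "HOL-Analysis.Analysis" "HOL-Library.Landau_Symbols"
begin

definition subdifferential :: "('a::real_inner \<Rightarrow> real) \<Rightarrow> 'a \<Rightarrow> 'a set" where
  "subdifferential g x = {v. \<forall>y. g y \<ge> g x + v \<bullet> (y - x)}"

definition vert :: "'a::real_vector set \<Rightarrow> 'a set" where
  "vert C = {v. v extreme_point_of C}"

definition H :: "('a::real_inner \<Rightarrow> real) \<Rightarrow> ('a \<Rightarrow> 'a) \<Rightarrow> 'a \<Rightarrow> ('a \<times> real) set" where
  "H g c xs = {(x, t). t - c xs \<bullet> x \<ge> g xs - c xs \<bullet> xs}"

text \<open>The state of the algorithm is the pair of the current polyhedron and the current
  piecewise linear minorant. Here \<open>c x\<close> is the subgradient of \<open>g\<close> chosen at \<open>x\<close>.\<close>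

definition alg_init ::
  "(real ^ 'n \<Rightarrow> real) \<Rightarrow> (real ^ 'n \<Rightarrow> real ^ 'n) \<Rightarrow> real ^ 'n \<Rightarrow> real ^ 'n \<Rightarrow>
    ((real ^ 'n) \<times> real) set \<times> (real ^ 'n \<Rightarrow> real)" where
  "alg_init g c l u =
    (let x0 = (1 / 2) *\<^sub>R (l + u)
     in (H g c x0 \<inter> (cbox l u \<times> UNIV), \<lambda>x. g x0 + c x0 \<bullet> (x - x0)))"

text \<open>One pass of the loop that does not stop. The relation is not functional, since any
  maximising vertex may be chosen; a state in which the algorithm stops has no successor.\<close>

definition alg_step ::
  "(real ^ 'n \<Rightarrow> real) \<Rightarrow> (real ^ 'n \<Rightarrow> real ^ 'n) \<Rightarrow> real \<Rightarrow>
    ((real ^ 'n) \<times> real) set \<times> (real ^ 'n \<Rightarrow> real) \<Rightarrow>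
    ((real ^ 'n) \<times> real) set \<times> (real ^ 'n \<Rightarrow> real) \<Rightarrow> bool" where
  "alg_step g c \<epsilon> = (\<lambda>(C, h) (C', h').
    \<exists>xb yb. is_arg_max (\<lambda>(x, y). g x - y) (\<lambda>z. z \<in> vert C) (xb, yb) \<and>
      g xb - yb > \<epsilon> \<and>
      C' = C \<inter> H g c xb \<and>
      h' = (\<lambda>x. max (h x) (g xb + c xb \<bullet> (x - xb))))"

definition infinite_run ::
  "(real ^ 'n \<Rightarrow> real) \<Rightarrow> (real ^ 'n \<Rightarrow> real ^ 'n) \<Rightarrow> real ^ 'n \<Rightarrow> real ^ 'n \<Rightarrow> real \<Rightarrow>
    (nat \<Rightarrow> ((real ^ 'n) \<times> real) set) \<Rightarrow> (nat \<Rightarrow> real ^ 'n \<Rightarrow> real) \<Rightarrow> bool" where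
  "infinite_run g c l u \<epsilon> C h \<longleftrightarrow>
    (C 0, h 0) = alg_init g c l u \<and>
    (\<forall>k. alg_step g c \<epsilon> (C k, h k) (C (Suc k), h (Suc k)))"

definition is_norm :: "('a::real_vector \<Rightarrow> real) \<Rightarrow> bool" where
  "is_norm N \<longleftrightarrow>
    (\<forall>x. N x \<ge> 0) \<and> (\<forall>x. N x = 0 \<longleftrightarrow> x = 0) \<and>
    (\<forall>a x. N (a *\<^sub>R x) = \<bar>a\<bar> * N x) \<and> (\<forall>x y. N (x + y) \<le> N x + N y)"

definition dist_to :: "('a::real_vector \<Rightarrow> real) \<Rightarrow> 'a \<Rightarrow> 'a set \<Rightarrow> real" where
  "dist_to N y B = (INF x\<in>B. N (y - x))"

text \<open>The infima and suprema are taken in the reals, so this is the Hausdorff distance only for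
  nonempty bounded sets.\<close>

definition hausdorff_distance :: "('a::real_vector \<Rightarrow> real) \<Rightarrow> 'a set \<Rightarrow> 'a set \<Rightarrow> real" where
  "hausdorff_distance N A B = max (SUP x\<in>A. dist_to N x B) (SUP y\<in>B. dist_to N y A)"

end

theory Submission
  imports Defs
begin

text \<open>
  Write \<open>e k = g (x k) - y k\<close> for the gap at the vertex \<open>(x k, y k)\<close> which is selected in step
  \<open>k\<close>. Three observations give the rate.

  First, \<open>e k\<close> bounds the whole vertical gap between \<open>g\<close> and \<open>h k\<close> over the box: the function
  \<open>(x, t) \<mapsto> g x - t\<close> is convex, so on the compact convex set \<open>A' k\<close> it is largest at an extreme
  point, and an extreme point of \<open>A' k\<close> is a vertex of \<open>C k\<close> or lies at height \<open>b\<close>, where the gap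
  is at most \<open>0\<close> (\<open>gap_le_vertex_gap\<close>). Moving a point of \<open>A' k\<close> vertically up to the graph of
  \<open>g\<close> therefore bounds the Hausdorff distance by a constant times \<open>e k\<close>. As the polyhedra
  shrink, \<open>e\<close> is nonincreasing.

  Secondly, \<open>(x k, y k)\<close> satisfies every earlier cut, so that \<open>y k\<close> is at least the value at
  \<open>x k\<close> of the tangent to \<open>g\<close> at \<open>x j\<close>, for \<open>j < k\<close>. Combined with the subgradient inequality
  at \<open>x k\<close> this gives \<open>e k \<le> (c (x k) - c (x j)) \<bullet> (x k - x j)\<close>, and since subgradients are
  bounded on the box (\<open>subgradients_bounded\<close>), \<open>e k \<le> 2 * L * dist (x k) (x j)\<close>.

  Hence \<open>x 0, \<dots>, x k\<close> are points of a bounded set with mutual distances at least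
  \<open>e k / (2 * L)\<close>, because \<open>e\<close> is nonincreasing. Comparing volumes (\<open>separated_sequence_bound\<close>),
  this forces \<open>e k\<close> to be of order \<open>k powr (- 1 / n)\<close>. The second claim follows from the first.
\<close>

section \<open>Hausdorff distance of nested sets\<close>

lemma is_norm_zero: "is_norm N \<Longrightarrow> N 0 = 0"
  by (simp add: is_norm_def)

lemma is_norm_nonneg: "is_norm N \<Longrightarrow> 0 \<le> N x"
  by (simp add: is_norm_def)

lemma dist_to_le:
  assumes "is_norm N" "a \<in> B"
  shows "dist_to N y B \<le> N (y - a)"
  unfolding dist_to_def
  by (rule cINF_lower) (use assms in \<open>auto intro!: bdd_belowI[of _ 0] simp: is_norm_nonneg\<close>)

lemma dist_to_nonneg:
  assumes "is_norm N" "B \<noteq> {}"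
  shows "0 \<le> dist_to N y B"
  unfolding dist_to_def by (rule cINF_greatest) (use assms in \<open>auto simp: is_norm_nonneg\<close>)

lemma dist_to_self:
  assumes "is_norm N" "y \<in> B"
  shows "dist_to N y B = 0"
proof (rule antisym)
  show "dist_to N y B \<le> 0"
    using dist_to_le[OF assms, of y] by (simp add: is_norm_zero[OF assms(1)])
  show "0 \<le> dist_to N y B"
    using assms by (intro dist_to_nonneg) auto
qed

text \<open>For nested sets only one of the two suprema matters: the other one runs over zeros. That it
  is attained, as \<open>0\<close>, also yields nonnegativity, which is not immediate for suprema in the
  reals.\<close>

lemma hausdorff_distance_nested:
  assumes N: "is_norm N" and sub: "A \<subseteq> B" and ne: "A \<noteq> {}"
    and near: "\<And>p. p \<in> B \<Longrightarrow> \<exists>a\<in>A. N (p - a) \<le> r"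
  shows "0 \<le> hausdorff_distance N B A" and "hausdorff_distance N B A \<le> r"
proof -
  have "(\<lambda>y. dist_to N y B) ` A = {0}"
    using dist_to_self[OF N] sub ne by (auto simp: image_iff subset_iff)
  then have zero: "(SUP y\<in>A. dist_to N y B) = 0"
    by simp
  then show "0 \<le> hausdorff_distance N B A"
    by (simp add: hausdorff_distance_def)
  have le: "(SUP p\<in>B. dist_to N p A) \<le> r"
  proof (rule cSUP_least)
    show "B \<noteq> {}" using sub ne by auto
    show "dist_to N p A \<le> r" if "p \<in> B" for p
      using near[OF that] dist_to_le[OF N] by (meson order_trans)
  qed
  obtain a where "a \<in> A" using ne by auto
  then have "0 \<le> r"
    using near[of a] sub is_norm_nonneg[OF N] by (meson order_trans subsetD)
  with le zero show "hausdorff_distance N B A \<le> r"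
    by (simp add: hausdorff_distance_def)
qed

section \<open>A convex function above a convex minorant\<close>

text \<open>Being extreme is a local property: if \<open>v\<close> lies inside a segment of the convex set \<open>C\<close>, then
  shrinking that segment towards \<open>v\<close> brings it into any given neighbourhood of \<open>v\<close>.\<close>

lemma extreme_point_of_Int_neighbourhood:
  fixes v :: "'a::real_normed_vector"
  assumes C: "convex C" and U: "open U" "v \<in> U" "U \<subseteq> T"
    and v: "v extreme_point_of (C \<inter> T)"
  shows "v extreme_point_of C"
proof -
  have vC: "v \<in> C" using v by (simp add: extreme_point_of_def)
  have False if ab: "a \<in> C" "b \<in> C" and seg: "v \<in> open_segment a b" for a b
  proof -
    obtain \<epsilon> where \<epsilon>: "\<epsilon> > 0" "ball v \<epsilon> \<subseteq> U"
      using U open_contains_ball by blast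
    define K where "K = 1 + norm (a - v) + norm (b - v)"
    define s where "s = \<epsilon> / (K + \<epsilon>)"
    have K: "K > 0" "norm (a - v) \<le> K" "norm (b - v) \<le> K"
      by (auto simp: K_def add_pos_nonneg)
    have s: "0 < s" "s < 1" "s * K < \<epsilon>"
      using K(1) \<epsilon>(1) by (auto simp: s_def field_simps)
    have shrunk: "v + s *\<^sub>R (p - v) \<in> C \<inter> T" if "p \<in> C" "norm (p - v) \<le> K" for p
    proof -
      have "v + s *\<^sub>R (p - v) = (1 - s) *\<^sub>R v + s *\<^sub>R p"
        by (simp add: algebra_simps)
      then have "v + s *\<^sub>R (p - v) \<in> C"
        using convexD_alt[OF C vC that(1), of s] s by simp
      moreover have "s * norm (p - v) < \<epsilon>"
        using mult_left_mono[OF that(2), of s] s by linarith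
      then have "v + s *\<^sub>R (p - v) \<in> ball v \<epsilon>"
        using s by (simp add: dist_norm)
      ultimately show ?thesis using \<epsilon> U by blast
    qed
    obtain t where t: "a \<noteq> b" "0 < t" "t < 1" "v = (1 - t) *\<^sub>R a + t *\<^sub>R b"
      using seg by (auto simp: in_segment)
    have "(1 - t) *\<^sub>R (v + s *\<^sub>R (a - v)) + t *\<^sub>R (v + s *\<^sub>R (b - v))
        = v + s *\<^sub>R (((1 - t) *\<^sub>R a + t *\<^sub>R b) - v)"
      by (simp add: algebra_simps)
    then have "v = (1 - t) *\<^sub>R (v + s *\<^sub>R (a - v)) + t *\<^sub>R (v + s *\<^sub>R (b - v))"
      using t(4) by simp
    moreover have "v + s *\<^sub>R (a - v) \<noteq> v + s *\<^sub>R (b - v)"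
      using t(1) s by simp
    ultimately have "v \<in> open_segment (v + s *\<^sub>R (a - v)) (v + s *\<^sub>R (b - v))"
      using t(2,3) by (auto simp: in_segment)
    then show False
      using v shrunk[OF ab(1) K(2)] shrunk[OF ab(2) K(3)] by (auto simp: extreme_point_of_def)
  qed
  then show ?thesis using vC by (auto simp: extreme_point_of_def)
qed

lemma compact_epigraph_Int_le:
  fixes h :: "'a::euclidean_space \<Rightarrow> real"
  assumes X: "compact X" and h: "continuous_on X h"
  shows "compact (epigraph X h \<inter> {z. snd z \<le> b})"
proof (cases "X = {}")
  case True
  then show ?thesis by (simp add: epigraph_def)
next
  case False
  then obtain x0 where x0: "x0 \<in> X" "\<And>x. x \<in> X \<Longrightarrow> h x0 \<le> h x"
    using continuous_attains_inf[OF X _ h] by blast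
  define D where "D = X \<times> {h x0..b}"
  have D: "compact D" unfolding D_def by (intro compact_Times X compact_Icc)
  have "continuous_on D (\<lambda>z. h (fst z) - snd z)"
    by (intro continuous_intros continuous_on_compose2[OF h continuous_on_fst]) (auto simp: D_def)
  then have "closed (D \<inter> (\<lambda>z. h (fst z) - snd z) -` {..0})"
    using D by (intro continuous_closed_preimage compact_imp_closed closed_atMost)
  then have "compact (D \<inter> (D \<inter> (\<lambda>z. h (fst z) - snd z) -` {..0}))"
    using D compact_Int_closed by blast
  also have "D \<inter> (D \<inter> (\<lambda>z. h (fst z) - snd z) -` {..0}) = epigraph X h \<inter> {z. snd z \<le> b}"
    using x0(2) by (fastforce simp: D_def epigraph_def)
  finally show ?thesis .
qed

text \<open>The gap \<open>(x, t) \<mapsto> g x - t\<close> is convex, hence bounded by its values at the extreme points of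
  a compact convex set. The epigraph itself is unbounded, and cutting it off at the height \<open>b\<close>
  creates new extreme points only at that height, where the gap is at most \<open>0\<close>.\<close>

lemma gap_le_vertex_gap:
  fixes g h :: "'a::euclidean_space \<Rightarrow> real"
  assumes X: "compact X"
    and g: "convex_on X g" and gb: "\<And>x. x \<in> X \<Longrightarrow> g x \<le> b"
    and h: "convex_on X h" "continuous_on X h"
    and M: "0 \<le> M" "\<And>x y. (x, y) \<in> vert (epigraph X h) \<Longrightarrow> g x - y \<le> M"
    and xt: "x \<in> X" "h x \<le> t" "t \<le> b"
  shows "g x - t \<le> M"
proof -
  define T where "T = {z :: 'a \<times> real. snd z \<le> b}"
  define D where "D = epigraph X h \<inter> T"
  define gap where "gap = (\<lambda>z :: 'a \<times> real. g (fst z) - snd z)"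
  have cE: "convex (epigraph X h)"
    using h(1) by (rule convex_epigraphI)
  have "T = {z. inner (0, 1) z \<le> b}"
    by (auto simp: T_def inner_prod_def)
  then have cT: "convex T"
    by (simp add: convex_halfspace_le)
  have cD: "convex D" unfolding D_def by (intro convex_Int cE cT)
  have D: "compact D"
    unfolding D_def T_def by (intro compact_epigraph_Int_le X h)
  have hull: "D = convex hull {z. z extreme_point_of D}"
    using D cD by (rule Krein_Milman_Minkowski)
  have "convex_on D gap"
  proof (rule convex_onI)
    fix s :: real and p q assume s: "0 < s" "s < 1" and pq: "p \<in> D" "q \<in> D"
    have "fst p \<in> X" "fst q \<in> X" using pq by (auto simp: D_def epigraph_def)
    then have "g ((1 - s) *\<^sub>R fst p + s *\<^sub>R fst q) \<le> (1 - s) * g (fst p) + s * g (fst q)"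
      using convex_onD[OF g, of s "fst p" "fst q"] s by simp
    then show "gap ((1 - s) *\<^sub>R p + s *\<^sub>R q) \<le> (1 - s) * gap p + s * gap q"
      by (simp add: gap_def algebra_simps)
  qed (rule cD)
  moreover have "gap z \<le> M" if z: "z extreme_point_of D" for z
  proof (cases "snd z < b")
    case True
    have "open {z :: 'a \<times> real. snd z < b}"
      by (intro open_Collect_less continuous_intros)
    then have "z extreme_point_of (epigraph X h)"
      using z True unfolding D_def
      by (intro extreme_point_of_Int_neighbourhood[OF cE, of "{z. snd z < b}"])
         (auto simp: T_def)
    then show ?thesis
      using M(2)[of "fst z" "snd z"] by (simp add: vert_def gap_def)
  next
    case False
    have "fst z \<in> X" using z by (auto simp: extreme_point_of_def D_def epigraph_def)
    then show ?thesis using gb[of "fst z"] False M(1) by (simp add: gap_def)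
  qed
  ultimately have "\<forall>z\<in>D. gap z \<le> M"
    using convex_on_convex_hull_bound[of "{z. z extreme_point_of D}" gap M, folded hull] by blast
  moreover have "(x, t) \<in> D" using xt by (simp add: D_def T_def mem_epigraph)
  ultimately show ?thesis by (force simp: gap_def)
qed

section \<open>Bounded subgradients\<close>

text \<open>A step of length one in the direction of the subgradient \<open>v\<close> raises a function by at least
  \<open>norm v\<close>, while a continuous function can rise only boundedly within distance one of a
  compact set.\<close>

lemma subgradients_bounded:
  fixes g :: "'a::euclidean_space \<Rightarrow> real"
  assumes g: "continuous_on UNIV g" and X: "bounded X"
  obtains L where "0 < L" "\<And>x v. x \<in> X \<Longrightarrow> v \<in> subdifferential g x \<Longrightarrow> norm v \<le> L"
proof -
  obtain R where R: "\<And>x. x \<in> X \<Longrightarrow> norm x \<le> R" using X by (auto simp: bounded_iff)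
  have "compact (g ` cball 0 (R + 1))"
    by (intro compact_continuous_image continuous_on_subset[OF g]) auto
  then have "bounded (g ` cball 0 (R + 1))" by (rule compact_imp_bounded)
  then obtain B where B: "B > 0" "\<And>x. x \<in> cball 0 (R + 1) \<Longrightarrow> \<bar>g x\<bar> \<le> B"
    unfolding bounded_pos by auto
  have "norm v \<le> 2 * B" if x: "x \<in> X" and v: "v \<in> subdifferential g x" for x v
  proof -
    have nx: "norm x \<le> R" using R x .
    have "norm (x + sgn v) \<le> R + 1"
      using norm_triangle_ineq[of x "sgn v"] nx by (auto simp: norm_sgn split: if_splits)
    then have "\<bar>g (x + sgn v)\<bar> \<le> B" "\<bar>g x\<bar> \<le> B" using B nx by auto
    moreover have "g (x + sgn v) \<ge> g x + v \<bullet> sgn v"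
      using v unfolding subdifferential_def by (metis (mono_tags, lifting) add_diff_cancel_left' mem_Collect_eq)
    moreover have "v \<bullet> sgn v = norm v"
      by (cases "v = 0") (simp_all add: sgn_div_norm dot_square_norm power2_eq_square)
    ultimately show ?thesis by linarith
  qed
  then show thesis using that[of "2 * B"] B(1) by simp
qed

section \<open>Packing\<close>

text \<open>The balls of radius \<open>\<delta> / 2\<close> around \<open>\<delta>\<close>-separated points of \<open>cball 0 R\<close> are disjoint and lie
  in a ball of radius \<open>R + \<delta> / 2\<close>; compare volumes.\<close>

lemma card_separated_le:
  fixes P :: "'a::euclidean_space set"
  assumes P: "finite P" "P \<subseteq> cball 0 R" and R: "0 \<le> R" and \<delta>: "0 < \<delta>"
    and sep: "\<And>p q. p \<in> P \<Longrightarrow> q \<in> P \<Longrightarrow> p \<noteq> q \<Longrightarrow> \<delta> \<le> dist p q"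
  shows "real (card P) * \<delta> ^ DIM('a) \<le> (2 * R + \<delta>) ^ DIM('a)"
proof -
  let ?n = "DIM('a)"
  let ?v = "unit_ball_vol (real ?n)"
  have "disjnt (ball p (\<delta> / 2)) (ball q (\<delta> / 2))" if "p \<in> P" "q \<in> P" "p \<noteq> q" for p q
    using sep[OF that] by (auto simp: disjnt_def intro!: disjoint_ballI)
  then have "measure lborel (\<Union>p\<in>P. ball p (\<delta> / 2)) = (\<Sum>p\<in>P. measure lborel (ball p (\<delta> / 2)))"
    using P(1) by (intro measure_UNION') (auto simp: pairwise_def intro!: fmeasurableI emeasure_lborel_ball_finite)
  also have "\<dots> = real (card P) * (?v * (\<delta> / 2) ^ ?n)"
    using \<delta> by (simp add: content_ball)
  finally have union: "measure lborel (\<Union>p\<in>P. ball p (\<delta> / 2)) = real (card P) * (?v * (\<delta> / 2) ^ ?n)" .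
  have "(\<Union>p\<in>P. ball p (\<delta> / 2)) \<subseteq> ball 0 (R + \<delta> / 2)"
  proof clarify
    fix p q assume "p \<in> P" and q: "q \<in> ball p (\<delta> / 2)"
    then have "dist 0 p \<le> R" using P(2) by auto
    with q show "q \<in> ball 0 (R + \<delta> / 2)"
      using dist_triangle[of 0 q p] by (simp del: dist_0_norm)
  qed
  then have "measure lborel (\<Union>p\<in>P. ball p (\<delta> / 2)) \<le> measure lborel (ball (0::'a) (R + \<delta> / 2))"
    using P(1) by (intro measure_mono_fmeasurable)
      (auto intro!: fmeasurableI emeasure_lborel_ball_finite)
  also have "\<dots> = ?v * (R + \<delta> / 2) ^ ?n"
    using R \<delta> by (simp add: content_ball)
  finally have "?v * (real (card P) * (\<delta> / 2) ^ ?n) \<le> ?v * (R + \<delta> / 2) ^ ?n"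
    by (simp add: union mult.left_commute)
  then have "real (card P) * (\<delta> / 2) ^ ?n \<le> (R + \<delta> / 2) ^ ?n"
    by simp
  moreover have "R + \<delta> / 2 = (2 * R + \<delta>) / 2" by (simp add: field_simps)
  ultimately show ?thesis
    by (simp add: power_divide field_simps)
qed

lemma separated_sequence_bound:
  fixes x :: "nat \<Rightarrow> 'a::euclidean_space"
  assumes x: "\<And>i. i \<le> k \<Longrightarrow> norm (x i) \<le> R" and k: "0 < k" and \<delta>: "0 < \<delta>"
    and sep: "\<And>i j. i < j \<Longrightarrow> j \<le> k \<Longrightarrow> \<delta> \<le> dist (x i) (x j)"
  shows "\<delta> \<le> 4 * R * real k powr (- (1 / real DIM('a)))"
proof -
  let ?n = "DIM('a)"
  have sep': "\<delta> \<le> dist (x i) (x j)" if "i \<le> k" "j \<le> k" "i \<noteq> j" for i j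
    using sep[of i j] sep[of j i] that by (cases "i < j") (auto simp: dist_commute)
  have inj: "inj_on x {..k}"
  proof (rule inj_onI, rule ccontr)
    fix i j assume "i \<in> {..k}" "j \<in> {..k}" "x i = x j" "i \<noteq> j"
    then show False using sep'[of i j] \<delta> by simp
  qed
  have "0 \<le> norm (x 0)" by simp
  then have R: "0 \<le> R" using x[of 0] by linarith
  have "dist (x 0) (x k) \<le> norm (x 0) + norm (x k)"
    by (simp add: dist_norm norm_triangle_ineq4)
  then have "\<delta> \<le> 2 * R"
    using sep[of 0 k] x[of 0] x[of k] k by simp
  have "real (card (x ` {..k})) * \<delta> ^ ?n \<le> (2 * R + \<delta>) ^ ?n"
    using x R \<delta> sep' by (intro card_separated_le) auto
  \<comment> \<open>As \<open>k > 0\<close>, there are two distinct points, hence \<open>\<delta> \<le> 2 * R\<close>.\<close>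
  also have "\<dots> \<le> (4 * R) ^ ?n"
    using \<open>\<delta> \<le> 2 * R\<close> R \<delta> by (intro power_mono) auto
  finally have "real (Suc k) * \<delta> ^ ?n \<le> (4 * R) ^ ?n"
    by (simp add: card_image[OF inj])
  moreover have "real k * \<delta> ^ ?n \<le> real (Suc k) * \<delta> ^ ?n"
    using \<delta> by (intro mult_right_mono) auto
  moreover have "(real k powr (1 / real ?n)) ^ ?n = real k"
    using k by (simp add: powr_realpow[symmetric] powr_powr)
  ultimately have "(real k powr (1 / real ?n) * \<delta>) ^ ?n \<le> (4 * R) ^ ?n"
    by (simp add: power_mult_distrib)
  then have "real k powr (1 / real ?n) * \<delta> \<le> 4 * R"
    using R \<delta> by (subst (asm) power_mono_iff) auto
  then show ?thesis
    using k by (simp add: powr_minus field_simps)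
qed

section \<open>Runs of the algorithm\<close>

lemma run_step:
  assumes "infinite_run g c l u \<epsilon> C h"
  obtains xb where "C (Suc k) = C k \<inter> H g c xb"
    and "h (Suc k) = (\<lambda>x. max (h k x) (g xb + c xb \<bullet> (x - xb)))"
proof -
  have "alg_step g c \<epsilon> (C k, h k) (C (Suc k), h (Suc k))"
    using assms by (simp add: infinite_run_def)
  then show thesis
    using that unfolding alg_step_def case_prod_conv by blast
qed

text \<open>Both components of the state carry the same information, which is why \<open>A' k = C k \<inter> S\<close>.\<close>

lemma run_polyhedron_eq_epigraph:
  assumes "infinite_run g c l u \<epsilon> C h"
  shows "C k = epigraph (cbox l u) (h k)"
proof (induction k)
  case 0
  show ?case
    using assms by (auto simp: infinite_run_def alg_init_def Let_def H_def epigraph_def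
        inner_diff_right algebra_simps)
next
  case (Suc k)
  obtain xb where "C (Suc k) = C k \<inter> H g c xb"
      "h (Suc k) = (\<lambda>x. max (h k x) (g xb + c xb \<bullet> (x - xb)))"
    using run_step[OF assms] by blast
  then show ?case
    using Suc by (auto simp: H_def epigraph_def inner_diff_right algebra_simps)
qed

lemma convex_on_max:
  fixes f g :: "'a::real_vector \<Rightarrow> real"
  assumes "convex_on S f" "convex_on S g"
  shows "convex_on S (\<lambda>x. max (f x) (g x))"
proof -
  have "epigraph S (\<lambda>x. max (f x) (g x)) = epigraph S f \<inter> epigraph S g"
    by (auto simp: epigraph_def)
  then show ?thesis
    using assms by (simp add: convex_epigraph[symmetric] convex_Int)
qed

lemma convex_on_affine_function:
  "convex_on UNIV (\<lambda>x :: 'a::real_inner. a + v \<bullet> (x - x0))"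
  by (rule convex_onI) (simp_all add: inner_diff_right inner_add_right algebra_simps)

lemma run_minorant_convex:
  assumes "infinite_run g c l u \<epsilon> C h"
  shows "convex_on UNIV (h k)"
proof (induction k)
  case 0
  have "h 0 = (\<lambda>x. g ((1 / 2) *\<^sub>R (l + u)) +
      c ((1 / 2) *\<^sub>R (l + u)) \<bullet> (x - (1 / 2) *\<^sub>R (l + u)))"
    using assms by (simp add: infinite_run_def alg_init_def Let_def)
  then show ?case
    by (simp only: convex_on_affine_function)
next
  case (Suc k)
  obtain xb where "h (Suc k) = (\<lambda>x. max (h k x) (g xb + c xb \<bullet> (x - xb)))"
    using run_step[OF assms] by blast
  then show ?case
    using Suc by (simp add: convex_on_max convex_on_affine_function)
qed

lemma run_minorant_le:
  assumes "infinite_run g c l u \<epsilon> C h" and "\<And>x. c x \<in> subdifferential g x"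
  shows "h k x \<le> g x"
proof (induction k)
  case 0
  show ?case
    using assms by (simp add: infinite_run_def alg_init_def Let_def subdifferential_def)
next
  case (Suc k)
  obtain xb where "h (Suc k) = (\<lambda>x. max (h k x) (g xb + c xb \<bullet> (x - xb)))"
    using run_step[OF assms(1)] by blast
  then show ?case
    using Suc assms(2)[of xb] by (simp add: subdifferential_def)
qed

lemma run_selected_vertices:
  assumes "infinite_run g c l u \<epsilon> C h"
  obtains x y where "\<And>k. (x k, y k) \<in> vert (C k)"
    and "\<And>k p q. (p, q) \<in> vert (C k) \<Longrightarrow> g p - q \<le> g (x k) - y k"
    and "\<And>k. g (x k) - y k > \<epsilon>"
    and "\<And>k. C (Suc k) = C k \<inter> H g c (x k)"
proof -
  have "\<forall>k. \<exists>z. is_arg_max (\<lambda>(x, y). g x - y) (\<lambda>z. z \<in> vert (C k)) z \<and>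
      g (fst z) - snd z > \<epsilon> \<and> C (Suc k) = C k \<inter> H g c (fst z)"
    using assms unfolding infinite_run_def alg_step_def by (simp, blast)
  then obtain z where z: "\<And>k. is_arg_max (\<lambda>(x, y). g x - y) (\<lambda>z. z \<in> vert (C k)) (z k)"
      "\<And>k. g (fst (z k)) - snd (z k) > \<epsilon>" "\<And>k. C (Suc k) = C k \<inter> H g c (fst (z k))"
    by metis
  show thesis
  proof (rule that[of "\<lambda>k. fst (z k)" "\<lambda>k. snd (z k)"])
    show "g p - q \<le> g (fst (z k)) - snd (z k)" if "(p, q) \<in> vert (C k)" for k p q
      using z(1)[of k] that by (auto simp: is_arg_max_linorder case_prod_beta)
  qed (use z in \<open>auto simp: is_arg_max_linorder\<close>)
qed

theorem corollary3p9:
  fixes g :: "real ^ 'n \<Rightarrow> real"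
    and c :: "real ^ 'n \<Rightarrow> real ^ 'n"
    and l u :: "real ^ 'n"
    and C :: "nat \<Rightarrow> ((real ^ 'n) \<times> real) set"
    and h :: "nat \<Rightarrow> real ^ 'n \<Rightarrow> real"
    and N :: "(real ^ 'n) \<times> real \<Rightarrow> real"
    and b :: real
    and X :: "(real ^ 'n) set"
    and S A :: "((real ^ 'n) \<times> real) set"
    and A' :: "nat \<Rightarrow> ((real ^ 'n) \<times> real) set"
  assumes box: "\<forall>i. l $ i < u $ i"
    and convex: "convex_on UNIV g"
    and closed: "closed (epigraph UNIV g)"
    and nonpolyhedral: "\<not> polyhedron (epigraph UNIV g)"
    and subgradients: "\<forall>x. c x \<in> subdifferential g x"
    and run: "infinite_run g c l u 0 C h"
    and norm: "is_norm N"
    and X: "X = cbox l u"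
    and b: "b = (SUP x\<in>X. g x)"
    and S: "S = {(x, t). t \<le> b}"
    and A: "A = epigraph UNIV g \<inter> (X \<times> UNIV) \<inter> S"
    and A': "\<And>k. A' k = epigraph UNIV (h k) \<inter> (X \<times> UNIV) \<inter> S"
  shows "(\<forall>k. A' k = C k \<inter> S) \<and>
    (\<lambda>k. hausdorff_distance N (A' k) A) \<in> O(\<lambda>k. real k powr (- (1 / real CARD('n)))) \<and>
    (\<lambda>k. hausdorff_distance N (A' k) A) \<longlonglongrightarrow> 0"
proof -
  have CE: "C k = epigraph X (h k)" for k
    using run_polyhedron_eq_epigraph[OF run] by (simp add: X)
  have A'E: "A' k = epigraph X (h k) \<inter> S" for k
    unfolding A' by (auto simp: epigraph_def)
  have sub: "c x \<in> subdifferential g x" for x using subgradients by simp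
  have cont: "continuous_on UNIV g"
    using convex by (intro convex_on_continuous) auto
  have X_compact: "compact X" by (simp add: X)
  have "bdd_above (g ` X)"
    using X_compact cont
    by (intro bounded_imp_bdd_above compact_imp_bounded compact_continuous_image)
       (auto intro: continuous_on_subset)
  then have gb: "g x \<le> b" if "x \<in> X" for x
    unfolding b using that by (intro cSUP_upper)

  from run obtain x y where vertex: "\<And>k. (x k, y k) \<in> vert (C k)"
    and maximal: "\<And>k p q. (p, q) \<in> vert (C k) \<Longrightarrow> g p - q \<le> g (x k) - y k"
    and gap_pos: "\<And>k. g (x k) - y k > 0"
    and cut: "\<And>k. C (Suc k) = C k \<inter> H g c (x k)"
    by (rule run_selected_vertices) blast
  define e where "e k = g (x k) - y k" for k
  have e_pos: "e k > 0" for k using gap_pos by (simp add: e_def)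
  have inC: "(x k, y k) \<in> C k" for k
    using vertex[of k] by (simp add: vert_def extreme_point_of_def)
  then have xX: "x k \<in> X" for k by (force simp: CE mem_epigraph)
  have yb: "y k \<le> b" for k using gb[OF xX, of k] gap_pos[of k] by linarith

  have gap_le: "g p - t \<le> e k" if "(p, t) \<in> A' k" for k p t
  proof (rule gap_le_vertex_gap[OF X_compact])
    show "convex_on X g" "convex_on X (h k)"
      using convex run_minorant_convex[OF run, of k] by (auto simp: X intro: convex_on_subset)
    show "continuous_on X (h k)"
      using run_minorant_convex[OF run, of k]
      by (meson convex_on_continuous continuous_on_subset open_UNIV subset_UNIV)
    show "g q - s \<le> e k" if "(q, s) \<in> vert (epigraph X (h k))" for q s
      using maximal[of q s k] that by (simp add: e_def CE)
  qed (use that gb less_imp_le[OF e_pos] in \<open>auto simp: A'E mem_epigraph S\<close>)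

  have C_decreasing: "C k \<subseteq> C j" if "j \<le> k" for j k
    using that by (rule lift_Suc_antimono_le[of C, rotated]) (simp add: cut)
  have e_decreasing: "e k \<le> e j" if "j \<le> k" for j k
  proof -
    \<comment> \<open>\<open>C k \<subseteq> C j\<close>, so the vertex selected in step \<open>k\<close> lies in the polyhedron over which \<open>e j\<close> is
      the largest gap; it lies below the height \<open>b\<close> because its gap is positive.\<close>
    have "(x k, y k) \<in> A' j"
      using C_decreasing[OF that] inC[of k] yb[of k] by (auto simp: A'E CE[symmetric] S)
    then show ?thesis using gap_le[of "x k" "y k" j] by (simp add: e_def)
  qed

  obtain L where L: "0 < L" "\<And>x v. x \<in> X \<Longrightarrow> v \<in> subdifferential g x \<Longrightarrow> norm v \<le> L"
    by (rule subgradients_bounded[OF cont compact_imp_bounded[OF X_compact]]) blast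
  have e_le_dist: "e k \<le> 2 * L * dist (x j) (x k)" if "j < k" for j k
  proof -
    have "(x k, y k) \<in> H g c (x j)"
      using C_decreasing[of "Suc j" k] that inC[of k] by (auto simp: cut)
    \<comment> \<open>The cut at \<open>x j\<close> bounds \<open>y k\<close> from below, and the subgradient inequality at \<open>x k\<close> bounds
      \<open>g (x k)\<close> from above; both bounds contain \<open>g (x j)\<close>, which cancels in the difference.\<close>
    then have "y k \<ge> g (x j) + c (x j) \<bullet> (x k - x j)"
      by (simp add: H_def inner_diff_right)
    moreover have "g (x j) \<ge> g (x k) + c (x k) \<bullet> (x j - x k)"
      using sub[of "x k"] by (simp add: subdifferential_def)
    ultimately have "e k \<le> (c (x k) - c (x j)) \<bullet> (x k - x j)"
      by (simp add: e_def inner_diff_left inner_diff_right)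
    also have "\<dots> \<le> norm (c (x k) - c (x j)) * norm (x k - x j)"
      by (rule norm_cauchy_schwarz)
    also have "\<dots> \<le> (2 * L) * norm (x k - x j)"
      using norm_triangle_ineq4[of "c (x k)" "c (x j)"] L(2)[OF xX sub, of j] L(2)[OF xX sub, of k]
      by (intro mult_right_mono) auto
    finally show ?thesis by (simp add: dist_norm norm_minus_commute)
  qed
  obtain R where R: "\<And>p. p \<in> X \<Longrightarrow> norm p \<le> R"
    using compact_imp_bounded[OF X_compact] by (auto simp: bounded_iff)
  have rate: "e k \<le> 8 * L * R * real k powr (- (1 / real CARD('n)))" if k: "0 < k" for k
  proof -
    have "e k / (2 * L) \<le> dist (x i) (x j)" if "i < j" "j \<le> k" for i j
      using e_decreasing[OF that(2)] e_le_dist[OF that(1)] L(1) by (simp add: field_simps)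
    then have "e k / (2 * L) \<le> 4 * R * real k powr (- (1 / real DIM(real ^ 'n)))"
      using k e_pos L(1) R[OF xX] by (intro separated_sequence_bound) auto
    then show ?thesis using L(1) by (simp add: field_simps)
  qed

  define K where "K = N (0, 1)"
  have K: "0 \<le> K" using norm by (simp add: K_def is_norm_nonneg)
  have A_sub: "A \<subseteq> A' k" for k
    unfolding A A' using run_minorant_le[OF run sub, of k]
    by (auto simp: epigraph_def intro: order_trans)
  have "(x 0, g (x 0)) \<in> A" using xX gb by (simp add: A S mem_epigraph)
  then have A_ne: "A \<noteq> {}" by auto
  \<comment> \<open>A point of \<open>A' k\<close> below the graph of \<open>g\<close> is moved vertically up to the graph, which is nowhere
    above the height \<open>b\<close>; only the norm of the vertical unit vector enters the bound.\<close>
  have near: "\<exists>a\<in>A. N (z - a) \<le> K * e k" if z: "z \<in> A' k" for z k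
  proof -
    obtain p t where [simp]: "z = (p, t)" by (cases z)
    have p: "p \<in> X" "t \<le> b" using z by (auto simp: A'E mem_epigraph S)
    show ?thesis
    proof (cases "g p \<le> t")
      case True
      then have "z \<in> A" using p by (simp add: A S mem_epigraph)
      moreover have "N (z - z) \<le> K * e k"
        using K e_pos[of k] by (simp only: diff_self is_norm_zero[OF norm]) simp
      ultimately show ?thesis by blast
    next
      case False
      have "z - (p, g p) = (t - g p) *\<^sub>R (0, 1)" by simp
      then have "N (z - (p, g p)) = \<bar>t - g p\<bar> * K"
        using norm by (simp only: is_norm_def K_def)
      also have "\<dots> \<le> K * e k"
        using gap_le[of p t k] z False K by (simp add: mult.commute mult_left_mono)
      finally have "N (z - (p, g p)) \<le> K * e k" .
      moreover have "(p, g p) \<in> A" using p gb by (simp add: A S mem_epigraph)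
      ultimately show ?thesis by blast
    qed
  qed
  have hd: "0 \<le> hausdorff_distance N (A' k) A" "hausdorff_distance N (A' k) A \<le> K * e k" for k
    using hausdorff_distance_nested[OF norm A_sub A_ne near] by auto

  have bigo: "(\<lambda>k. hausdorff_distance N (A' k) A) \<in> O(\<lambda>k. real k powr (- (1 / real CARD('n))))"
  proof (rule bigoI[where c = "K * (8 * L * R)"])
    have "norm (hausdorff_distance N (A' k) A)
        \<le> K * (8 * L * R) * norm (real k powr (- (1 / real CARD('n))))" if "0 < k" for k
      using hd[of k] mult_left_mono[OF rate[OF that] K] by (simp add: mult.assoc)
    then show "\<forall>\<^sub>F k in sequentially. norm (hausdorff_distance N (A' k) A)
        \<le> K * (8 * L * R) * norm (real k powr (- (1 / real CARD('n))))"
      unfolding eventually_sequentially by (intro exI[of _ 1]) auto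
  qed
  moreover have "(\<lambda>k. real k powr (- (1 / real CARD('n)))) \<longlonglongrightarrow> 0"
    by (intro tendsto_neg_powr filterlim_real_sequentially) simp
  then have "(\<lambda>k. real k powr (- (1 / real CARD('n)))) \<in> o(\<lambda>k. 1 :: real)"
    by (intro smalloI_tendsto) auto
  with bigo have "(\<lambda>k. hausdorff_distance N (A' k) A) \<in> o(\<lambda>k. 1)"
    by (rule landau_o.big_small_trans)
  then have "(\<lambda>k. hausdorff_distance N (A' k) A) \<longlonglongrightarrow> 0"
    using smalloD_tendsto by fastforce
  ultimately show ?thesis by (simp add: A'E CE)
qed

end
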